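(* Let $\gamma_1,\gamma_2:\mathbb{R}\to\mathbb{R}$ be (differentiable) class $\mathcal{K}$ functions. Without loss of generality, assume $\gamma_1'(0)\ge\gamma_2'(0)$ (otherwise swap the roles of the two functions). Define $$K=\frac{4\gamma_1'(0)\gamma_2'(0)}{(\gamma_1'(0)+\gamma_2'(0))^2}.$$ Consider the second-order rigid body $\dot p=v$, $\dot v=a$, $\dot R=R[\omega]_\times$, $\dot\omega=\alpha$ with state $x=(p,R,v,\omega)$ and control input $u=(a,\alpha)\in\mathbb{R}^3\times\mathbb{R}^3$. Let $u^*(x)$ be a given nominal control law and let $\gamma_0,d_m,d_M>0$ be constants such that $\gamma_0>K$ and $d_m<1<d_M$. Then there exists $M>0$ such that the control law $u$ resulting from the solution of the quadratic program $$ \begin{aligned} \min_{u=(a,\alpha)\in\mathbb{R}^6,\;c_1,c_2\in\mathbb{R}}\quad & \|u-u^*(x)\|^2\\ \text{s.t.}\quad & \tilde d\,\bigl(\langle \mathrm{grad}_p h,a\rangle+2\langle \mathrm{Hess}_p h[v_\perp],v_\parallel\rangle\bigr)+c_1\,\Gamma(x)\ \ge\ 0,\\ & \langle \mathrm{grad}_R h,\alpha\rangle+\langle \mathrm{Hess}_R h[\omega],\omega\rangle+2\langle \mathrm{Hess}_R h[\omega],v\rangle+\langle \mathrm{Hess}_p h[v_\perp],v_\perp\rangle+c_2\,\Gamma(x)\ \ge\ M,\\ & c_1+c_2=\gamma_0,\\ & \frac{Kd_M-\gamma_0}{d_M-1}\le c_2\le\frac{Kd_m-\gamma_0}{d_m-1},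 \end{aligned} $$ where $\Gamma(x)=\gamma_1'(h(x))\,L_fh(x)+\gamma_2\bigl(L_fh(x)+\gamma_1(h(x))\bigr)$, renders the set $\mathcal{C}_h=\{(p,R)\in\mathbb{R}^3\times SO(3): h\ge0\}$ forward invariant whenever $\tilde d\in[d_m,d_M]$.
   Context: Setting: $p\in\mathbb{R}^3$ is the position and $R\in SO(3)$ the orientation (body to inertial frame) of an agent; $v$ and $a$ are its linear velocity and acceleration in the inertial frame, $\omega$ and $\alpha$ its angular velocity and acceleration in the body frame. A unit vector $e_c\in\mathbb{R}^3$ (camera optical axis in the body frame), an angle $\psi_F\in(0,\pi/2)$ (half-aperture of the conic field of view) and a single fixed feature point $q\in\mathbb{R}^3$ are given. Notation: $[w]_\times$ is the skew-symmetric $3\times 3$ matrix with $[w]_\times y=w\times y$. For $p\ne q$: $d=d(p)=\|q-p\|$, $\beta=\beta(p)=(q-p)/\|q-p\|$, $P_\beta=I-\beta\beta^T$. The function $\hat d(p,t)$ is a real-valued estimate of $d(p)$ available to the agent, and $\tilde d(p,t)=d(p)/\hat d(p,t)$ is the relative error. The candidate barrier function is $h(x)=\beta(p)^TRe_c-\cos\psi_F$, which depends only on $(p,R)$ and is defined and smooth for $p\neq q$. The velocity is decomposed as $v=v_\parallel+v_\perp$ with $v_\parallel=(\beta^Tv)\beta$ and $v_\perp=P_\beta v=-d\,\dot\beta$, where $\dot\beta=-\frac1d P_\beta v$; the quantity $\dot\beta$ is assumed to be measurable by the agent. The terms in the program are $$\mathrm{grad}_p h=-\frac{P_\beta R e_c}{d},\qquad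 \langle \mathrm{grad}_R h,w\rangle=-\beta^TR[e_c]_\times w\quad(w\in\mathbb{R}^3),$$ $$\langle \mathrm{Hess}_p h[v_\perp],v_\perp\rangle=-(\beta^TRe_c)(\dot\beta^T\dot\beta),\qquad \langle \mathrm{Hess}_p h[v_\perp],v_\parallel\rangle=\frac{(v^T\beta)\,\dot\beta^TP_\beta Re_c}{d},$$ $$\langle \mathrm{Hess}_R h[\omega],v\rangle=v^T\frac{P_\beta R[e_c]_\times}{d}\omega,\qquad \langle \mathrm{Hess}_R h[\omega],\omega\rangle=\omega^T[R^T\beta]_\times[e_c]_\times\omega,$$ and $L_fh(x)=\langle \mathrm{grad}_p h,v\rangle+\langle \mathrm{grad}_R h,\omega\rangle$, which equals $\dot h$ along trajectories. A class $\mathcal{K}$ function is a strictly increasing function $\gamma:\mathbb{R}\to\mathbb{R}$ with $\gamma(0)=0$; $\gamma'$ denotes its derivative. A set is forward invariant if trajectories starting in it remain in it for all later times.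
   Formalization: Forward invariance is proved for trajectories whose initial state also satisfies L_f h + γ_1(h) ≥ 0; without a condition on the initial velocities the claim fails, since a state with h = 0 and L_f h < 0 leaves C_h at once for every M. *)

theory Defs
  imports "HOL-Analysis.Analysis"
begin

definition class_K :: "(real \<Rightarrow> real) \<Rightarrow> bool" where
  "class_K \<gamma> \<longleftrightarrow> strict_mono \<gamma> \<and> \<gamma> 0 = 0"

definition skew :: "real^3 \<Rightarrow> real^3^3" where
  "skew w = matrix (cross3 w)"

lemma skew_mult: "skew w *v y = cross3 w y"
  unfolding skew_def by (rule matrix_works, unfold_locales) (simp_all add: cross3_simps)

record state =
  pos :: "real^3"
  rot :: "real^3^3"
  vel :: "real^3"
  angvel :: "real^3"

text \<open>A control input is a pair of a linear acceleration (inertial frame) and an angular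
  acceleration (body frame). The norm of the product type is the Euclidean norm of R^6.\<close>

type_synonym control = "(real^3) \<times> (real^3)"

text \<open>States in which \<open>h\<close> is defined: the rotation part lies in SO(3) and the agent is not at the
  feature point.\<close>

definition state_space :: "real^3 \<Rightarrow> state set" where
  "state_space q = {x. pos x \<noteq> q \<and> rotation_matrix (rot x)}"

definition feature_dist :: "real^3 \<Rightarrow> real^3 \<Rightarrow> real" where
  "feature_dist q p = norm (q - p)"

definition bearing :: "real^3 \<Rightarrow> real^3 \<Rightarrow> real^3" where
  "bearing q p = (q - p) /\<^sub>R norm (q - p)"

definition proj_mat :: "real^3 \<Rightarrow> real^3^3" where
  "proj_mat b = mat 1 - (\<chi> i j. b $ i * b $ j)"

definition bearing_rate :: "real^3 \<Rightarrow> state \<Rightarrow> real^3" where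
  "bearing_rate q x =
     - ((1 / feature_dist q (pos x)) *\<^sub>R (proj_mat (bearing q (pos x)) *v vel x))"

definition rel_err :: "(real^3 \<Rightarrow> real \<Rightarrow> real) \<Rightarrow> real^3 \<Rightarrow> real^3 \<Rightarrow> real \<Rightarrow> real" where
  "rel_err dhat q p t = feature_dist q p / dhat p t"

definition barrier :: "real^3 \<Rightarrow> real^3 \<Rightarrow> real \<Rightarrow> real^3 \<Rightarrow> real^3^3 \<Rightarrow> real" where
  "barrier q ec \<psi> p R = bearing q p \<bullet> (R *v ec) - cos \<psi>"

definition safe_set :: "real^3 \<Rightarrow> real^3 \<Rightarrow> real \<Rightarrow> ((real^3) \<times> (real^3^3)) set" where
  "safe_set q ec \<psi> = {(p, R). p \<noteq> q \<and> rotation_matrix R \<and> barrier q ec \<psi> p R \<ge> 0}"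

definition grad_p :: "real^3 \<Rightarrow> real^3 \<Rightarrow> state \<Rightarrow> real^3" where
  "grad_p q ec x =
     - ((1 / feature_dist q (pos x)) *\<^sub>R (proj_mat (bearing q (pos x)) *v (rot x *v ec)))"

text \<open>The gradient with respect to the rotation and all second-order terms are represented by their
  pairings; e.g. \<open>grad_R q ec x w\<close> is the pairing of the rotational gradient with \<open>w\<close>.\<close>

definition grad_R :: "real^3 \<Rightarrow> real^3 \<Rightarrow> state \<Rightarrow> real^3 \<Rightarrow> real" where
  "grad_R q ec x w = - (bearing q (pos x) \<bullet> ((rot x ** skew ec) *v w))"

definition hess_p_perp_perp :: "real^3 \<Rightarrow> real^3 \<Rightarrow> state \<Rightarrow> real" where
  "hess_p_perp_perp q ec x =
     - ((bearing q (pos x) \<bullet> (rot x *v ec)) * (bearing_rate q x \<bullet> bearing_rate q x))"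

definition hess_p_perp_par :: "real^3 \<Rightarrow> real^3 \<Rightarrow> state \<Rightarrow> real" where
  "hess_p_perp_par q ec x =
     (vel x \<bullet> bearing q (pos x)) *
     (bearing_rate q x \<bullet> (proj_mat (bearing q (pos x)) *v (rot x *v ec))) /
     feature_dist q (pos x)"

definition hess_R_omega_v :: "real^3 \<Rightarrow> real^3 \<Rightarrow> state \<Rightarrow> real" where
  "hess_R_omega_v q ec x =
     vel x \<bullet> ((1 / feature_dist q (pos x)) *\<^sub>R
       ((proj_mat (bearing q (pos x)) ** rot x ** skew ec) *v angvel x))"

definition hess_R_omega_omega :: "real^3 \<Rightarrow> real^3 \<Rightarrow> state \<Rightarrow> real" where
  "hess_R_omega_omega q ec x =
     angvel x \<bullet>
       ((skew (transpose (rot x) *v bearing q (pos x)) ** skew ec) *v angvel x)"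

definition Lf_barrier :: "real^3 \<Rightarrow> real^3 \<Rightarrow> state \<Rightarrow> real" where
  "Lf_barrier q ec x = grad_p q ec x \<bullet> vel x + grad_R q ec x (angvel x)"

definition hocbf_term ::
  "real^3 \<Rightarrow> real^3 \<Rightarrow> real \<Rightarrow> (real \<Rightarrow> real) \<Rightarrow> (real \<Rightarrow> real) \<Rightarrow> state \<Rightarrow> real" where
  "hocbf_term q ec \<psi> \<gamma>1 \<gamma>2 x =
     deriv \<gamma>1 (barrier q ec \<psi> (pos x) (rot x)) * Lf_barrier q ec x +
     \<gamma>2 (Lf_barrier q ec x + \<gamma>1 (barrier q ec \<psi> (pos x) (rot x)))"

definition qp_feasible ::
  "real^3 \<Rightarrow> real^3 \<Rightarrow> real \<Rightarrow> (real^3 \<Rightarrow> real \<Rightarrow> real) \<Rightarrow> (real \<Rightarrow> real) \<Rightarrow> (real \<Rightarrow> real) \<Rightarrow>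
   real \<Rightarrow> real \<Rightarrow> real \<Rightarrow> real \<Rightarrow> real \<Rightarrow> real \<Rightarrow> state \<Rightarrow> control \<Rightarrow> real \<Rightarrow> real \<Rightarrow> bool" where
  "qp_feasible q ec \<psi> dhat \<gamma>1 \<gamma>2 K \<gamma>0 dm dM M t x u c1 c2 \<longleftrightarrow>
     rel_err dhat q (pos x) t * (grad_p q ec x \<bullet> fst u + 2 * hess_p_perp_par q ec x)
       + c1 * hocbf_term q ec \<psi> \<gamma>1 \<gamma>2 x \<ge> 0 \<and>
     grad_R q ec x (snd u) + hess_R_omega_omega q ec x + 2 * hess_R_omega_v q ec x
       + hess_p_perp_perp q ec x + c2 * hocbf_term q ec \<psi> \<gamma>1 \<gamma>2 x \<ge> M \<and>
     c1 + c2 = \<gamma>0 \<and>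
     (K * dM - \<gamma>0) / (dM - 1) \<le> c2 \<and> c2 \<le> (K * dm - \<gamma>0) / (dm - 1)"

definition qp_solution ::
  "real^3 \<Rightarrow> real^3 \<Rightarrow> real \<Rightarrow> (real^3 \<Rightarrow> real \<Rightarrow> real) \<Rightarrow> (real \<Rightarrow> real) \<Rightarrow> (real \<Rightarrow> real) \<Rightarrow>
   real \<Rightarrow> real \<Rightarrow> real \<Rightarrow> real \<Rightarrow> real \<Rightarrow> (state \<Rightarrow> control) \<Rightarrow> real \<Rightarrow> state \<Rightarrow> control \<Rightarrow> bool" where
  "qp_solution q ec \<psi> dhat \<gamma>1 \<gamma>2 K \<gamma>0 dm dM M ustar t x u \<longleftrightarrow>
     (\<exists>c1 c2. qp_feasible q ec \<psi> dhat \<gamma>1 \<gamma>2 K \<gamma>0 dm dM M t x u c1 c2 \<and>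
        (\<forall>u' c1' c2'. qp_feasible q ec \<psi> dhat \<gamma>1 \<gamma>2 K \<gamma>0 dm dM M t x u' c1' c2' \<longrightarrow>
           (norm (u - ustar x))\<^sup>2 \<le> (norm (u' - ustar x))\<^sup>2))"

text \<open>The program need not be feasible in every state (for instance at \<open>R e\<^sub>c = \<beta>\<close>, where both
  gradients vanish), so the control law is a partial function: its domain is the set of times and
  states at which the program has a solution, and the law returns that solution there.
  It depends on time through the distance estimate.\<close>

definition qp_domain ::
  "real^3 \<Rightarrow> real^3 \<Rightarrow> real \<Rightarrow> (real^3 \<Rightarrow> real \<Rightarrow> real) \<Rightarrow> (real \<Rightarrow> real) \<Rightarrow> (real \<Rightarrow> real) \<Rightarrow>
   real \<Rightarrow> real \<Rightarrow> real \<Rightarrow> real \<Rightarrow> real \<Rightarrow> (state \<Rightarrow> control) \<Rightarrow> (real \<times> state) set" where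
  "qp_domain q ec \<psi> dhat \<gamma>1 \<gamma>2 K \<gamma>0 dm dM M ustar =
     {(t, x). x \<in> state_space q \<and>
        (\<exists>u. qp_solution q ec \<psi> dhat \<gamma>1 \<gamma>2 K \<gamma>0 dm dM M ustar t x u)}"

definition qp_control_law ::
  "real^3 \<Rightarrow> real^3 \<Rightarrow> real \<Rightarrow> (real^3 \<Rightarrow> real \<Rightarrow> real) \<Rightarrow> (real \<Rightarrow> real) \<Rightarrow> (real \<Rightarrow> real) \<Rightarrow>
   real \<Rightarrow> real \<Rightarrow> real \<Rightarrow> real \<Rightarrow> real \<Rightarrow> (state \<Rightarrow> control) \<Rightarrow> (real \<Rightarrow> state \<Rightarrow> control) \<Rightarrow> bool" where
  "qp_control_law q ec \<psi> dhat \<gamma>1 \<gamma>2 K \<gamma>0 dm dM M ustar u \<longleftrightarrow>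
     (\<forall>(t, x) \<in> qp_domain q ec \<psi> dhat \<gamma>1 \<gamma>2 K \<gamma>0 dm dM M ustar.
        qp_solution q ec \<psi> dhat \<gamma>1 \<gamma>2 K \<gamma>0 dm dM M ustar t x (u t x))"

text \<open>Trajectories of the rigid body under a feedback law \<open>u\<close> with domain \<open>D\<close>, on a time interval
  \<open>J\<close> that may be bounded or unbounded. Derivatives are one-sided at end points of \<open>J\<close>.\<close>

definition closed_loop_trajectory ::
  "(real \<times> state) set \<Rightarrow> (real \<Rightarrow> state \<Rightarrow> control) \<Rightarrow> real set \<Rightarrow> (real \<Rightarrow> state) \<Rightarrow> bool" where
  "closed_loop_trajectory D u J x \<longleftrightarrow>
     is_interval J \<and>
     (\<forall>t\<in>J. (t, x t) \<in> D \<and>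
        ((\<lambda>s. pos (x s)) has_vector_derivative vel (x t)) (at t within J) \<and>
        ((\<lambda>s. vel (x s)) has_vector_derivative fst (u t (x t))) (at t within J) \<and>
        ((\<lambda>s. rot (x s)) has_vector_derivative (rot (x t) ** skew (angvel (x t)))) (at t within J) \<and>
        ((\<lambda>s. angvel (x s)) has_vector_derivative snd (u t (x t))) (at t within J))"

text \<open>The condition on the initial velocities under which \<open>h \<ge> 0\<close> can be maintained for a barrier
  of relative degree two. Without it, a trajectory with \<open>h = 0\<close> and \<open>L\<^sub>f h < 0\<close> at the
  initial time leaves \<open>h \<ge> 0\<close> at once, whatever the control does.\<close>

definition admissible_velocity ::
  "real^3 \<Rightarrow> real^3 \<Rightarrow> real \<Rightarrow> (real \<Rightarrow> real) \<Rightarrow> state \<Rightarrow> bool" where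
  "admissible_velocity q ec \<psi> \<gamma>1 x \<longleftrightarrow>
     Lf_barrier q ec x + \<gamma>1 (barrier q ec \<psi> (pos x) (rot x)) \<ge> 0"

end

theory Submission
  imports Defs
begin

text \<open>Along a trajectory the second derivative of \<open>h\<close> is exactly the sum of the two left-hand sides
  of the program without their \<open>\<Gamma>\<close>-terms and without the factor \<open>d / dhat\<close>. Hence feasibility gives
  \<open>h'' \<ge> M - k \<Gamma>\<close> with \<open>k = (\<gamma>0 - c2) / (d / dhat) + c2\<close>, and the bounds on \<open>c2\<close> say that
  \<open>K \<le> k \<le> \<kappa>\<close> for some constant \<open>\<kappa>\<close>. Since \<open>h \<le> 2\<close>, the term \<open>\<Gamma>\<close> is bounded above as long as
  \<open>h' \<le> 0\<close>, so a large \<open>M\<close> forces \<open>h'' \<ge> m\<close> there, with \<open>m\<close> as large as desired. Then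
  \<open>(min h' 0)\<^sup>2 - 2 m h\<close> is nonincreasing. It is nonpositive initially: \<open>h' \<ge> - \<gamma>1 h \<ge> - C h\<close> on
  \<open>[0, 2]\<close>, hence \<open>(min h' 0)\<^sup>2 \<le> 2 C\<^sup>2 h\<close>. So \<open>h\<close> stays nonnegative.\<close>

section \<open>Projection, rotation and a bound on the barrier\<close>

lemma proj_mat_mult: "proj_mat b *v w = w - (b \<bullet> w) *\<^sub>R b"
proof -
  have "(\<chi> i j. b $ i * b $ j) *v w = (b \<bullet> w) *\<^sub>R b"
    by (simp add: vec_eq_iff matrix_vector_mult_def inner_vec_def sum_distrib_left ac_simps)
  then show ?thesis
    by (simp add: proj_mat_def matrix_vector_mult_diff_rdistrib)
qed

lemma inner_proj_mat_swap: "(proj_mat b *v w) \<bullet> v = w \<bullet> (proj_mat b *v v)"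
  by (simp add: proj_mat_mult inner_diff_left inner_diff_right inner_commute)

lemma norm_bearing: "p \<noteq> q \<Longrightarrow> norm (bearing q p) = 1"
  by (simp add: bearing_def)

text \<open>Supplies the product rule for a time-dependent matrix acting on a time-dependent
  vector.\<close>

lemma bounded_bilinear_matrix_vector:
  "bounded_bilinear ((*v) :: real^'n^'m \<Rightarrow> real^'n \<Rightarrow> real^'m)"
  unfolding bilinear_conv_bounded_bilinear[symmetric] bilinear_def
  by (auto intro!: linearI simp: matrix_vector_mult_add_rdistrib matrix_vector_right_distrib
    matrix_vector_mult_scaleR scaleR_matrix_vector_assoc)

lemma bounded_bilinear_cross3: "bounded_bilinear cross3"
  using bilinear_cross bilinear_conv_bounded_bilinear by blast

lemma rotation_norm: "rotation_matrix R \<Longrightarrow> norm (R *v w) = norm w" for R :: "real^3^3"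
  by (metis matrix_of_matrix_vector_mul matrix_vector_mul_linear orthogonal_transformation_matrix
      orthogonal_transformation_norm rotation_matrix_def)

text \<open>Cauchy-Schwarz bounds the inner product by 1, and \<open>- cos \<psi>\<close> is at most
  1. The bound is uniform in the state, so that \<open>M\<close> can be chosen once for all
  states.\<close>

lemma barrier_le_2:
  assumes "p \<noteq> q" "rotation_matrix R" "norm ec = 1"
  shows "barrier q ec \<psi> p R \<le> 2"
proof -
  have "bearing q p \<bullet> (R *v ec) \<le> 1"
    using norm_cauchy_schwarz[of "bearing q p" "R *v ec"] assms
    by (simp add: norm_bearing rotation_norm)
  then show ?thesis
    using cos_ge_minus_one[of \<psi>] by (simp add: barrier_def del: cos_ge_minus_one)
qed

section \<open>Kinematics of the bearing\<close>

lemma bearing_rate_eq: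
  "bearing_rate q x = - ((1 / feature_dist q (pos x)) *\<^sub>R
     (vel x - (bearing q (pos x) \<bullet> vel x) *\<^sub>R bearing q (pos x)))"
  by (simp add: bearing_rate_def proj_mat_mult)

lemma bearing_inner_bearing_rate:
  assumes "pos x \<noteq> q" shows "bearing q (pos x) \<bullet> bearing_rate q x = 0"
  using norm_bearing[OF assms]
  by (simp add: bearing_rate_eq inner_diff_right flip: power2_norm_eq_inner)

text \<open>Up to the factor -d, \<open>bearing_rate\<close> is the component of the velocity
  orthogonal to the bearing; the parallel component drops out of the inner product.\<close>

lemma vel_inner_bearing_rate:
  assumes "pos x \<noteq> q"
  shows "bearing_rate q x \<bullet> vel x
    = - (feature_dist q (pos x) * (bearing_rate q x \<bullet> bearing_rate q x))"
proof -
  have "vel x = (bearing q (pos x) \<bullet> vel x) *\<^sub>R bearing q (pos x)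
      - feature_dist q (pos x) *\<^sub>R bearing_rate q x"
    using assms by (simp add: bearing_rate_eq feature_dist_def)
  then have "bearing_rate q x \<bullet> vel x = bearing_rate q x \<bullet> 
     ((bearing q (pos x) \<bullet> vel x) *\<^sub>R bearing q (pos x)
      - feature_dist q (pos x) *\<^sub>R bearing_rate q x)" by metis
  then show ?thesis
    using bearing_inner_bearing_rate[OF assms] by (simp add: inner_diff_right inner_commute)
qed

lemma inverse_feature_dist_deriv:
  assumes "(p has_vector_derivative v) (at t within S)" "p t \<noteq> q"
  shows "((\<lambda>s. 1 / feature_dist q (p s)) has_real_derivative
     (bearing q (p t) \<bullet> v) / (feature_dist q (p t))\<^sup>2) (at t within S)"
proof -
  have "((\<lambda>s. norm (q - p s)) has_derivative (\<lambda>h. ((q - p t) /\<^sub>R norm (q - p t)) \<bullet> (- (h *\<^sub>R v)))) (at t within S)"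
    (is "(_ has_derivative ?D) _")
  proof -
    have "((\<lambda>s. q - p s) has_derivative (\<lambda>h. - (h *\<^sub>R v))) (at t within S)"
      using assms(1) by (auto intro!: derivative_eq_intros simp: has_vector_derivative_def)
    from has_derivative_compose[OF this has_derivative_norm] assms(2)
    show ?thesis by (simp add: sgn_div_norm inner_commute)
  qed
  then have "((\<lambda>s. feature_dist q (p s)) has_real_derivative - (bearing q (p t) \<bullet> v)) (at t within S)"
    unfolding feature_dist_def bearing_def has_field_derivative_def
    by (rule has_derivative_eq_rhs) (simp add: fun_eq_iff)
  then show ?thesis
    using assms(2)
    by (auto intro!: derivative_eq_intros simp: feature_dist_def power2_eq_square)
qed

lemma bearing_deriv:
  assumes "((\<lambda>s. pos (x s)) has_vector_derivative vel (x t)) (at t within S)" "pos (x t) \<noteq> q"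
  shows "((\<lambda>s. bearing q (pos (x s))) has_vector_derivative bearing_rate q (x t)) (at t within S)"
proof -
  have *: "bearing q p = (1 / feature_dist q p) *\<^sub>R (q - p)" for p
    by (simp add: bearing_def feature_dist_def divide_inverse)
  have "((\<lambda>s. (1 / feature_dist q (pos (x s))) *\<^sub>R (q - pos (x s))) has_vector_derivative
     (1 / feature_dist q (pos (x t))) *\<^sub>R (- vel (x t)) +
     ((bearing q (pos (x t)) \<bullet> vel (x t)) / (feature_dist q (pos (x t)))\<^sup>2) *\<^sub>R (q - pos (x t)))
     (at t within S)"
    by (rule derivative_eq_intros inverse_feature_dist_deriv assms refl)+ simp
  moreover have "((bearing q (pos (x t)) \<bullet> vel (x t)) / (feature_dist q (pos (x t)))\<^sup>2) *\<^sub>R (q - pos (x t))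
     = (1 / feature_dist q (pos (x t))) *\<^sub>R
         ((bearing q (pos (x t)) \<bullet> vel (x t)) *\<^sub>R bearing q (pos (x t)))"
    by (simp add: bearing_def feature_dist_def power2_eq_square divide_inverse)
  ultimately show ?thesis
    by (simp add: * bearing_rate_eq scaleR_diff_right)
qed

text \<open>The term along \<open>r\<close> carries a factor 2 because it arises twice: from
  differentiating the bearing inside the projection and from differentiating 1/d. The last term is
  the centripetal one, which keeps the bearing on the unit sphere.\<close>

lemma bearing_rate_deriv:
  assumes "((\<lambda>s. pos (x s)) has_vector_derivative vel (x t)) (at t within S)"
    and "((\<lambda>s. vel (x s)) has_vector_derivative a) (at t within S)"
    and "pos (x t) \<noteq> q"
  defines "\<beta> \<equiv> bearing q (pos (x t))" and "d \<equiv> feature_dist q (pos (x t))"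
    and "r \<equiv> bearing_rate q (x t)"
  shows "((\<lambda>s. bearing_rate q (x s)) has_vector_derivative
    - ((1 / d) *\<^sub>R (proj_mat \<beta> *v a)) + (2 * (\<beta> \<bullet> vel (x t)) / d) *\<^sub>R r - (r \<bullet> r) *\<^sub>R \<beta>)
    (at t within S)"
proof -
  have d: "d \<noteq> 0" using assms by (simp add: feature_dist_def)
  have bd: "((\<lambda>s. bearing q (pos (x s))) has_vector_derivative r) (at t within S)"
    unfolding r_def by (rule bearing_deriv) fact+
  have id: "((\<lambda>s. 1 / feature_dist q (pos (x s))) has_real_derivative
     (\<beta> \<bullet> vel (x t)) / d\<^sup>2) (at t within S)"
    unfolding \<beta>_def d_def by (rule inverse_feature_dist_deriv) fact+
  have ip: "((\<lambda>s. bearing q (pos (x s)) \<bullet> vel (x s)) has_real_derivative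
     \<beta> \<bullet> a + r \<bullet> vel (x t)) (at t within S)"
    unfolding has_real_derivative_iff_has_vector_derivative \<beta>_def
    by (rule bounded_bilinear.has_vector_derivative[OF bounded_bilinear_inner bd assms(2)])
  have "((\<lambda>s. bearing_rate q (x s)) has_vector_derivative
    - ((1 / d) *\<^sub>R (a - ((\<beta> \<bullet> vel (x t)) *\<^sub>R r + (\<beta> \<bullet> a + r \<bullet> vel (x t)) *\<^sub>R \<beta>))
      + ((\<beta> \<bullet> vel (x t)) / d\<^sup>2) *\<^sub>R (vel (x t) - (\<beta> \<bullet> vel (x t)) *\<^sub>R \<beta>)))
    (at t within S)"
    unfolding bearing_rate_eq d_def \<beta>_def
    by (rule derivative_eq_intros id[unfolded d_def \<beta>_def] ip[unfolded \<beta>_def] bd assms(2) refl)+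
  moreover have "((\<beta> \<bullet> vel (x t)) / d\<^sup>2) *\<^sub>R (vel (x t) - (\<beta> \<bullet> vel (x t)) *\<^sub>R \<beta>)
      = - ((\<beta> \<bullet> vel (x t)) / d) *\<^sub>R r"
    using d by (simp add: r_def bearing_rate_eq \<beta>_def[symmetric] d_def[symmetric] power2_eq_square)
  moreover have "r \<bullet> vel (x t) = - (d * (r \<bullet> r))"
    unfolding r_def d_def by (rule vel_inner_bearing_rate) fact
  ultimately have "((\<lambda>s. bearing_rate q (x s)) has_vector_derivative
    - ((1 / d) *\<^sub>R (a - ((\<beta> \<bullet> vel (x t)) *\<^sub>R r + (\<beta> \<bullet> a - d * (r \<bullet> r)) *\<^sub>R \<beta>))
      - ((\<beta> \<bullet> vel (x t)) / d) *\<^sub>R r)) (at t within S)"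
    by simp
  moreover have "- ((1 / d) *\<^sub>R (a - ((\<beta> \<bullet> vel (x t)) *\<^sub>R r + (\<beta> \<bullet> a - d * (r \<bullet> r)) *\<^sub>R \<beta>))
      - ((\<beta> \<bullet> vel (x t)) / d) *\<^sub>R r)
    = - ((1 / d) *\<^sub>R (proj_mat \<beta> *v a)) + (2 * (\<beta> \<bullet> vel (x t)) / d) *\<^sub>R r - (r \<bullet> r) *\<^sub>R \<beta>"
    using d by (simp add: proj_mat_mult vec_eq_iff field_simps)
  ultimately show ?thesis by simp
qed

section \<open>Kinematics of the camera axis\<close>

lemma axis_deriv:
  assumes "((\<lambda>s. rot (x s)) has_vector_derivative (rot (x t) ** skew (angvel (x t)))) (at t within S)"
  shows "((\<lambda>s. rot (x s) *v ec) has_vector_derivative rot (x t) *v cross3 (angvel (x t)) ec) (at t within S)"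
  using bounded_bilinear.has_vector_derivative[OF bounded_bilinear_matrix_vector assms has_vector_derivative_const[of ec]]
  by (simp add: skew_mult flip: matrix_vector_mul_assoc)

lemma axis_rate_deriv:
  assumes "((\<lambda>s. rot (x s)) has_vector_derivative (rot (x t) ** skew (angvel (x t)))) (at t within S)"
    and "((\<lambda>s. angvel (x s)) has_vector_derivative \<alpha>) (at t within S)"
  shows "((\<lambda>s. rot (x s) *v cross3 (angvel (x s)) ec) has_vector_derivative
    rot (x t) *v cross3 \<alpha> ec + rot (x t) *v cross3 (angvel (x t)) (cross3 (angvel (x t)) ec)) (at t within S)"
proof -
  have "((\<lambda>s. cross3 (angvel (x s)) ec) has_vector_derivative cross3 \<alpha> ec) (at t within S)"
    using bounded_bilinear.has_vector_derivative[OF bounded_bilinear_cross3 assms(2) has_vector_derivative_const[of ec]]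
    by simp
  from bounded_bilinear.has_vector_derivative[OF bounded_bilinear_matrix_vector assms(1) this]
  show ?thesis
    by (simp add: skew_mult flip: matrix_vector_mul_assoc)
qed

section \<open>The terms of the program and the derivatives of h\<close>

lemma grad_R_eq: "grad_R q ec x w = bearing q (pos x) \<bullet> (rot x *v cross3 w ec)"
proof -
  have "(rot x ** skew ec) *v w = - (rot x *v cross3 w ec)"
    by (metis cross_skew matrix_vector_mul_assoc skew_mult vec.neg)
  then show ?thesis by (simp add: grad_R_def)
qed

lemma grad_p_inner_vel: "grad_p q ec x \<bullet> vel x = bearing_rate q x \<bullet> (rot x *v ec)"
  by (simp add: grad_p_def bearing_rate_def inner_proj_mat_swap)
    (metis inner_commute inner_proj_mat_swap)

text \<open>This is the product rule form of h', with one term for the moving bearing and one for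
  the moving axis, ready to be differentiated again.\<close>

lemma Lf_barrier_eq:
  "Lf_barrier q ec x =
     bearing_rate q x \<bullet> (rot x *v ec) + bearing q (pos x) \<bullet> (rot x *v cross3 (angvel x) ec)"
  by (simp add: Lf_barrier_def grad_p_inner_vel grad_R_eq)

lemma barrier_deriv:
  assumes "((\<lambda>s. pos (x s)) has_vector_derivative vel (x t)) (at t within S)"
    and "((\<lambda>s. rot (x s)) has_vector_derivative (rot (x t) ** skew (angvel (x t)))) (at t within S)"
    and "pos (x t) \<noteq> q"
  shows "((\<lambda>s. barrier q ec \<psi> (pos (x s)) (rot (x s))) has_real_derivative Lf_barrier q ec (x t))
    (at t within S)"
proof -
  have "((\<lambda>s. bearing q (pos (x s)) \<bullet> (rot (x s) *v ec)) has_real_derivative Lf_barrier q ec (x t))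
    (at t within S)"
    using bounded_bilinear.has_vector_derivative[OF bounded_bilinear_inner
        bearing_deriv[OF assms(1,3)] axis_deriv[OF assms(2), of ec]]
    by (simp add: Lf_barrier_eq has_real_derivative_iff_has_vector_derivative add.commute)
  then show ?thesis
    unfolding barrier_def by (auto intro!: derivative_eq_intros)
qed

lemma hess_R_omega_omega_eq:
  "hess_R_omega_omega q ec x =
     bearing q (pos x) \<bullet> (rot x *v cross3 (angvel x) (cross3 (angvel x) ec))"
proof -
  \<comment> \<open>Cyclic invariance of the triple product, with two sign changes that cancel. The
    transpose then moves \<open>rot x\<close> to the other factor.\<close>
  have *: "w \<bullet> cross3 b (cross3 e w) = b \<bullet> cross3 w (cross3 w e)" for w b e :: "real^3"
    by (simp add: cross3_simps)
  show ?thesis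
    unfolding hess_R_omega_omega_def matrix_vector_mul_assoc[symmetric] skew_mult
      *[of "angvel x" "transpose (rot x) *v bearing q (pos x)"]
    by (simp add: dot_lmul_matrix)
qed

lemma hess_R_omega_v_eq:
  "hess_R_omega_v q ec x = bearing_rate q x \<bullet> (rot x *v cross3 (angvel x) ec)"
proof -
  have *: "(proj_mat b ** R ** skew ec) *v w = - (proj_mat b *v (R *v cross3 w ec))" for b R w
    by (metis cross_skew matrix_vector_mul_assoc skew_mult vec.neg)
  show ?thesis
    by (simp add: hess_R_omega_v_def * bearing_rate_def inner_proj_mat_swap)
qed

text \<open>The two parts of h'' are split as in the constraints of the program: this one collects
  the terms with an explicit 1/d, while the terms of \<open>barrier_accel_rot\<close> depend on d
  only through \<open>bearing_rate\<close>.\<close>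

definition barrier_accel_pos :: "real^3 \<Rightarrow> real^3 \<Rightarrow> state \<Rightarrow> real^3 \<Rightarrow> real" where
  "barrier_accel_pos q ec x a = grad_p q ec x \<bullet> a + 2 * hess_p_perp_par q ec x"

definition barrier_accel_rot :: "real^3 \<Rightarrow> real^3 \<Rightarrow> state \<Rightarrow> real^3 \<Rightarrow> real" where
  "barrier_accel_rot q ec x \<alpha> = grad_R q ec x \<alpha> + hess_R_omega_omega q ec x +
     2 * hess_R_omega_v q ec x + hess_p_perp_perp q ec x"

text \<open>Differentiating both products of \<open>Lf_barrier_eq\<close> yields the mixed product
  of bearing rate and axis rate twice, hence the factor 2 at \<open>hess_R_omega_v\<close>.\<close>

lemma Lf_barrier_deriv:
  assumes "((\<lambda>s. pos (x s)) has_vector_derivative vel (x t)) (at t within S)"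
    and "((\<lambda>s. vel (x s)) has_vector_derivative a) (at t within S)"
    and "((\<lambda>s. rot (x s)) has_vector_derivative (rot (x t) ** skew (angvel (x t)))) (at t within S)"
    and "((\<lambda>s. angvel (x s)) has_vector_derivative \<alpha>) (at t within S)"
    and "pos (x t) \<noteq> q"
  shows "((\<lambda>s. Lf_barrier q ec (x s)) has_real_derivative
     barrier_accel_pos q ec (x t) a + barrier_accel_rot q ec (x t) \<alpha>) (at t within S)"
proof -
  let ?\<beta> = "bearing q (pos (x t))" and ?r = "bearing_rate q (x t)"
    and ?d = "feature_dist q (pos (x t))" and ?w = "rot (x t) *v ec"
  note bilin = bounded_bilinear.has_vector_derivative[OF bounded_bilinear_inner]
  note D = has_vector_derivative_add[OF
      bilin[OF bearing_rate_deriv[OF assms(1,2,5)] axis_deriv[OF assms(3), of ec]]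
      bilin[OF bearing_deriv[OF assms(1,5)] axis_rate_deriv[OF assms(3,4), of ec]]]
  \<comment> \<open>The bearing rate is orthogonal to the bearing, so it absorbs the
    projection.\<close>
  have "?r \<bullet> (proj_mat ?\<beta> *v ?w) = ?r \<bullet> ?w"
    using bearing_inner_bearing_rate[OF assms(5)]
    by (simp add: proj_mat_mult inner_diff_right inner_commute)
  then have par: "2 * hess_p_perp_par q ec (x t) = ((2 * (?\<beta> \<bullet> vel (x t)) / ?d) *\<^sub>R ?r) \<bullet> ?w"
    by (simp add: hess_p_perp_par_def inner_commute)
  have a: "grad_p q ec (x t) \<bullet> a = - ((1 / ?d) *\<^sub>R (proj_mat ?\<beta> *v a)) \<bullet> ?w"
    by (simp add: grad_p_def inner_proj_mat_swap)
    (metis inner_commute inner_proj_mat_swap)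
  show ?thesis
    unfolding has_real_derivative_iff_has_vector_derivative Lf_barrier_eq
    by (rule has_vector_derivative_eq_rhs[OF D])
      (simp only: barrier_accel_pos_def barrier_accel_rot_def par a hess_R_omega_omega_eq
        hess_R_omega_v_eq grad_R_eq hess_p_perp_perp_def inner_add_left inner_diff_left
        inner_add_right inner_scaleR_left, simp add: algebra_simps)
qed

section \<open>A comparison argument on the real line\<close>

lemma min_0_power2_deriv:
  "((\<lambda>y::real. (min y 0)\<^sup>2) has_real_derivative 2 * min y 0) (at y)"
proof -
  consider "y < 0" | "y = 0" | "y > 0" by linarith
  then show ?thesis
  proof cases
    case 1
    have "((\<lambda>y::real. y\<^sup>2) has_real_derivative 2 * min y 0) (at y)"
      using 1 by (auto intro!: derivative_eq_intros)
    then show ?thesis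
      by (rule has_field_derivative_transform_within_open[of _ _ _ "{..<0}"]) (use 1 in auto)
  next
    case 2
    \<comment> \<open>Squaring smooths the kink of \<open>min y 0\<close>: at 0 the difference
      quotient is at most \<open>\<bar>h\<bar>\<close> in absolute value.\<close>
    have "((\<lambda>h. (min h 0)\<^sup>2 / h) \<longlongrightarrow> 0) (at (0::real))"
    proof (rule Lim_null_comparison[where g = abs])
      show "\<forall>\<^sub>F h in at (0::real). norm ((min h 0)\<^sup>2 / h) \<le> \<bar>h\<bar>"
        by (auto simp: eventually_at_filter min_def power2_eq_square)
      show "(abs \<longlongrightarrow> 0) (at (0::real))"
        by (auto intro!: tendsto_eq_intros)
    qed
    then show ?thesis
      using 2 by (simp add: DERIV_def)
  next
    case 3
    have "((\<lambda>y::real. 0) has_real_derivative 2 * min y 0) (at y)"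
      using 3 by (auto intro!: derivative_eq_intros)
    then show ?thesis
      by (rule has_field_derivative_transform_within_open[of _ _ _ "{0<..}"]) (use 3 in auto)
  qed
qed

text \<open>An energy argument with E = (min h' 0)^2 - 2 m h. Where h' \<le> 0, its derivative is 2
  h' (h'' - m) \<le> 0; where h' > 0, the truncation vanishes and -2 m h' < 0 is left. Hence -2 m
  h(b) \<le> E(b) \<le> E(a) \<le> 0.\<close>

lemma nonneg_if_deriv_rises_while_nonpos:
  fixes h h' h'' :: "real \<Rightarrow> real"
  assumes h: "\<And>s. s \<in> {a..b} \<Longrightarrow> (h has_real_derivative h' s) (at s within {a..b})"
    and h': "\<And>s. s \<in> {a..b} \<Longrightarrow> (h' has_real_derivative h'' s) (at s within {a..b})"
    and "0 < m" and rise: "\<And>s. s \<in> {a..b} \<Longrightarrow> h' s \<le> 0 \<Longrightarrow> m \<le> h'' s"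
    and init: "(min (h' a) 0)\<^sup>2 \<le> 2 * m * h a" and "a \<le> b"
  shows "0 \<le> h b"
proof -
  define E where "E s = (min (h' s) 0)\<^sup>2 - 2 * m * h s" for s
  define E' where "E' s = 2 * min (h' s) 0 * h'' s - 2 * m * h' s" for s
  have dE: "(E has_real_derivative E' s) (at s within {a..b})" if "s \<in> {a..b}" for s
    unfolding E_def E'_def
    by (rule derivative_eq_intros DERIV_chain2[OF min_0_power2_deriv] h h' that refl)+ simp
  have E': "E' s \<le> 0" if "s \<in> {a..b}" for s
  proof (cases "h' s \<le> 0")
    case True
    then have "h' s * (h'' s - m) \<le> 0"
      using rise[OF that True] by (intro mult_nonpos_nonneg) auto
    with True show ?thesis by (simp add: E'_def algebra_simps)
  qed (use \<open>0 < m\<close> in \<open>simp add: E'_def\<close>)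
  have "E b \<le> E a"
  \<comment> \<open>Two-sided derivatives are available in the interior; at the end points
    continuity is enough.\<close>
  proof (rule DERIV_nonpos_imp_decreasing_open[OF \<open>a \<le> b\<close>])
    show "continuous_on {a..b} E"
      using dE DERIV_continuous_on by blast
    fix s assume s: "a < s" "s < b"
    then have "(E has_real_derivative E' s) (at s)"
      using dE[of s] at_within_Icc_at[of a s b] by simp
    then show "\<exists>y. (E has_real_derivative y) (at s) \<and> y \<le> 0"
      using E'[of s] s by auto
  qed
  then have "0 \<le> 2 * m * h b"
    using init zero_le_power2[of "min (h' b) 0"] unfolding E_def by linarith
  then show ?thesis
    using \<open>0 < m\<close> by (simp add: zero_le_mult_iff)
qed

section \<open>Class K functions and the effective gain\<close>

lemma class_K_deriv_nonneg:
  assumes "class_K \<gamma>" "\<gamma> differentiable (at s)"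
  shows "0 \<le> deriv \<gamma> s"
proof (rule mono_on_imp_deriv_nonneg[of UNIV \<gamma> _ s])
  show "mono_on UNIV \<gamma>"
    using assms(1) by (simp add: class_K_def strict_mono_mono)
  show "(\<gamma> has_real_derivative deriv \<gamma> s) (at s)"
    using assms(2) DERIV_deriv_iff_real_differentiable by blast
qed auto

text \<open>Near 0 the derivative there bounds the slope; at distance at least \<open>e\<close> from
  0, monotonicity gives \<gamma>(s) \<le> \<gamma>(b) \<le> (\<gamma>(b) / e) s. The absolute value
  in \<open>C\<close> ensures that it is nonnegative.\<close>

lemma class_K_linear_bound:
  assumes "class_K \<gamma>" "\<gamma> differentiable (at 0)" "0 \<le> b"
  obtains C where "0 \<le> C" "\<And>s. \<lbrakk>0 \<le> s; s \<le> b\<rbrakk> \<Longrightarrow> \<gamma> s \<le> C * s"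
proof -
  have mono: "\<gamma> s \<le> \<gamma> s'" if "s \<le> s'" for s s'
    using assms(1) that by (auto simp: class_K_def strict_mono_less_eq)
  have [simp]: "\<gamma> 0 = 0" using assms(1) by (simp add: class_K_def)
  obtain D where D: "(\<gamma> has_real_derivative D) (at 0)"
    using assms(2) real_differentiable_def by blast
  then have "((\<lambda>s. \<gamma> s / s) \<longlongrightarrow> D) (at 0)"
    by (simp add: DERIV_def)
  then have "\<forall>\<^sub>F s in at 0. \<gamma> s / s < D + 1"
    by (rule order_tendstoD) simp
  then obtain e where e: "0 < e" "\<And>s. s \<noteq> 0 \<Longrightarrow> \<bar>s\<bar> < e \<Longrightarrow> \<gamma> s / s < D + 1"
    by (auto simp: eventually_at dist_real_def)
  define C where "C = max (\<bar>D + 1\<bar>) (\<gamma> b / e)"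
  show thesis
  proof
    show "0 \<le> C" by (simp add: C_def)
    fix s :: real assume s: "0 \<le> s" "s \<le> b"
    consider "s = 0" | "0 < s" "s < e" | "e \<le> s" using s by linarith
    then show "\<gamma> s \<le> C * s"
    proof cases
      case 2
      then have "\<gamma> s \<le> (D + 1) * s" using e(2)[of s] by (simp add: field_simps)
      also have "\<dots> \<le> C * s" using s by (intro mult_right_mono) (auto simp: C_def)
      finally show ?thesis .
    next
      case 3
      have "\<gamma> s \<le> \<gamma> b / e * e" using mono[OF s(2)] e(1) by simp
      also have "\<dots> \<le> C * s"
        using 3 e(1) s by (intro mult_mono) (auto simp: C_def)
      finally show ?thesis .
    qed simp
  qed
qed

text \<open>After multiplication by \<open>r\<close> the claim reads (K - c) (r - 1) \<le> \<gamma>0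
  - K. This is affine in \<open>r\<close>, so it need only hold at \<open>dm\<close> and
  \<open>dM\<close>, where it is exactly the upper and the lower bound on \<open>c\<close>.\<close>

lemma effective_gain_ge:
  fixes K \<gamma>0 dm dM r c :: real
  assumes "K < \<gamma>0" "0 < dm" "dm < 1" "1 < dM" "r \<in> {dm..dM}"
    and lo: "(K * dM - \<gamma>0) / (dM - 1) \<le> c" and hi: "c \<le> (K * dm - \<gamma>0) / (dm - 1)"
  shows "K \<le> (\<gamma>0 - c) / r + c"
proof -
  have hi': "(c - K) * (1 - dm) \<le> \<gamma>0 - K"
  proof -
    \<comment> \<open>Rewritten with a positive denominator, so that clearing it preserves the
      inequality.\<close>
    have "(K * dm - \<gamma>0) / (dm - 1) = (\<gamma>0 - K * dm) / (1 - dm)"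
      by (metis minus_diff_eq minus_divide_divide)
    then show ?thesis
      using hi assms by (simp add: le_divide_eq algebra_simps)
  qed
  have lo': "(K - c) * (dM - 1) \<le> \<gamma>0 - K"
    using lo assms by (simp add: divide_le_eq algebra_simps)
  have "(K - c) * (r - 1) \<le> \<gamma>0 - K"
  proof (cases "K \<le> c")
    case True
    have "(c - K) * (1 - r) \<le> (c - K) * (1 - dm)"
      using True assms by (intro mult_left_mono) auto
    with hi' show ?thesis by (simp add: algebra_simps)
  next
    case False
    have "(K - c) * (r - 1) \<le> (K - c) * (dM - 1)"
      using False assms by (intro mult_left_mono) auto
    with lo' show ?thesis by simp
  qed
  then have "K * r \<le> \<gamma>0 - c + c * r" by (simp add: algebra_simps)
  moreover have "0 < r" using assms by auto
  ultimately show ?thesis by (simp add: field_simps)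
qed

lemma effective_gain_le:
  fixes \<gamma>0 dm r c lo hi :: real
  assumes "0 < \<gamma>0" "0 < dm" "dm \<le> r" "lo \<le> c" "c \<le> hi"
  shows "(\<gamma>0 - c) / r + c \<le> (\<gamma>0 + \<bar>lo\<bar> + \<bar>hi\<bar>) / dm + (\<bar>lo\<bar> + \<bar>hi\<bar>)"
proof -
  have "(\<gamma>0 - c) / r \<le> (\<gamma>0 + \<bar>lo\<bar> + \<bar>hi\<bar>) / dm"
    using assms by (intro frac_le) auto
  then show ?thesis using assms by linarith
qed

theorem theorem3:
  fixes q ec :: "real^3" and \<psi> :: real
    and dhat :: "real^3 \<Rightarrow> real \<Rightarrow> real"
    and \<gamma>1 \<gamma>2 :: "real \<Rightarrow> real"
    and ustar :: "state \<Rightarrow> control"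
    and K \<gamma>0 dm dM :: real
  assumes "norm ec = 1"
    and "0 < \<psi>" and "\<psi> < pi / 2"
    and "class_K \<gamma>1" and "\<And>s. \<gamma>1 differentiable (at s)"
    and "class_K \<gamma>2" and "\<And>s. \<gamma>2 differentiable (at s)"
    and "deriv \<gamma>1 0 \<ge> deriv \<gamma>2 0"
    and "K = 4 * deriv \<gamma>1 0 * deriv \<gamma>2 0 / (deriv \<gamma>1 0 + deriv \<gamma>2 0)\<^sup>2"
    and "\<gamma>0 > 0" and "dm > 0" and "dM > 0"
    and "\<gamma>0 > K" and "dm < 1" and "1 < dM"
  shows "\<exists>M>0. \<forall>u. qp_control_law q ec \<psi> dhat \<gamma>1 \<gamma>2 K \<gamma>0 dm dM M ustar u \<longrightarrow>
    (\<forall>J x t0.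
       closed_loop_trajectory (qp_domain q ec \<psi> dhat \<gamma>1 \<gamma>2 K \<gamma>0 dm dM M ustar) u J x \<and>
       (\<forall>t\<in>J. rel_err dhat q (pos (x t)) t \<in> {dm..dM}) \<and>
       t0 \<in> J \<and> (pos (x t0), rot (x t0)) \<in> safe_set q ec \<psi> \<and>
       admissible_velocity q ec \<psi> \<gamma>1 (x t0) \<longrightarrow>
       (\<forall>t\<in>J. t0 \<le> t \<longrightarrow> (pos (x t), rot (x t)) \<in> safe_set q ec \<psi>))"
proof -
  obtain C where C: "0 \<le> C" "\<And>s. \<lbrakk>0 \<le> s; s \<le> 2\<rbrakk> \<Longrightarrow> \<gamma>1 s \<le> C * s"
    using class_K_linear_bound[OF assms(4) assms(5), of 2] by auto
  have deriv1: "0 \<le> deriv \<gamma>1 s" and deriv2: "0 \<le> deriv \<gamma>2 s" for s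
    by (rule class_K_deriv_nonneg; fact assms)+
  \<comment> \<open>If both derivatives vanish, division by zero makes \<open>K\<close> equal to
    0.\<close>
  have "0 \<le> K" unfolding assms(9) by (simp add: deriv1 deriv2)
  have mono1: "\<gamma>1 s \<le> \<gamma>1 s'" and mono2: "\<gamma>2 s \<le> \<gamma>2 s'" if "s \<le> s'" for s s'
    using assms(4,6) that by (auto simp: class_K_def strict_mono_less_eq)
  have [simp]: "\<gamma>1 0 = 0" "\<gamma>2 0 = 0"
    using assms(4,6) by (simp_all add: class_K_def)

  \<comment> \<open>Constants that depend neither on the control law nor on the trajectory\<close>
  define lo where "lo = (K * dM - \<gamma>0) / (dM - 1)"
  define hi where "hi = (K * dm - \<gamma>0) / (dm - 1)"
  define \<kappa> where "\<kappa> = (\<gamma>0 + \<bar>lo\<bar> + \<bar>hi\<bar>) / dm + (\<bar>lo\<bar> + \<bar>hi\<bar>)"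
  \<comment> \<open>Bounds \<open>hocbf_term\<close> from above while h' \<le> 0: its first summand
    is then nonpositive, and the argument of \<open>\<gamma>2\<close> is at most
    \<open>\<gamma>1 2\<close>.\<close>
  define G where "G = \<gamma>2 (\<gamma>1 2)"
  \<comment> \<open>The square of \<open>C\<close> serves the initial condition; adding 1 keeps
    \<open>m\<close> positive when \<open>C\<close> is 0.\<close>
  define m where "m = C\<^sup>2 + 1"
  \<comment> \<open>Compensates the largest possible loss \<open>\<kappa> * G\<close> and leaves
    \<open>m\<close>.\<close>
  define M where "M = m + \<kappa> * G"
  have "0 \<le> \<kappa>"
    using assms(10,11) by (auto simp: \<kappa>_def)
  have "0 \<le> G"
    using mono2[OF mono1[of 0 2]] by (simp add: G_def)
  have "0 < m"
    by (simp add: m_def add_nonneg_pos)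
  have "0 < M"
    using \<open>0 \<le> \<kappa>\<close> \<open>0 \<le> G\<close> \<open>0 < m\<close> by (simp add: M_def add_pos_nonneg)

  \<comment> \<open>Lower bound on h'' while h does not increase\<close>
  have rise: "m \<le> barrier_accel_pos q ec x (fst v) + barrier_accel_rot q ec x (snd v)"
    if feas: "qp_feasible q ec \<psi> dhat \<gamma>1 \<gamma>2 K \<gamma>0 dm dM M t x v c1 c2"
      and dom: "x \<in> state_space q" and err: "rel_err dhat q (pos x) t \<in> {dm..dM}"
      and falling: "Lf_barrier q ec x \<le> 0" for t x v c1 c2
  proof -
    define r where "r = rel_err dhat q (pos x) t"
    define \<Gamma> where "\<Gamma> = hocbf_term q ec \<psi> \<gamma>1 \<gamma>2 x"
    define k where "k = (\<gamma>0 - c2) / r + c2"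
    let ?A = "barrier_accel_pos q ec x (fst v)" and ?B = "barrier_accel_rot q ec x (snd v)"
    have A: "0 \<le> r * ?A + c1 * \<Gamma>" and B: "M \<le> ?B + c2 * \<Gamma>"
      and c: "c1 = \<gamma>0 - c2" "lo \<le> c2" "c2 \<le> hi"
      using feas by (auto simp: qp_feasible_def barrier_accel_pos_def barrier_accel_rot_def
          r_def \<Gamma>_def lo_def hi_def)
    have r: "r \<in> {dm..dM}" "0 < r" using err assms(11) by (auto simp: r_def)
    \<comment> \<open>Division by \<open>r\<close> isolates the translational part of h''. Adding
      the second constraint gives \<Gamma> the total coefficient c1 / r + c2, which is
      \<open>k\<close>.\<close>
    have "0 \<le> (r * ?A + c1 * \<Gamma>) / r" using A r(2) by simp
    also have "\<dots> = ?A + c1 / r * \<Gamma>" using r(2) by (simp add: field_simps)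
    finally have accel: "M - k * \<Gamma> \<le> ?A + ?B"
      using B by (simp add: k_def c(1) algebra_simps)
    have "K \<le> k"
      unfolding k_def by (rule effective_gain_ge[OF _ _ _ _ r(1)])
        (use assms c in \<open>auto simp: lo_def hi_def\<close>)
    with \<open>0 \<le> K\<close> have "0 \<le> k" by simp
    have "k \<le> \<kappa>"
      unfolding k_def \<kappa>_def using assms c r by (intro effective_gain_le) auto
    have "barrier q ec \<psi> (pos x) (rot x) \<le> 2"
      using dom assms(1) by (intro barrier_le_2) (auto simp: state_space_def)
    then have "\<gamma>2 (Lf_barrier q ec x + \<gamma>1 (barrier q ec \<psi> (pos x) (rot x))) \<le> G"
      using falling mono1[of "barrier q ec \<psi> (pos x) (rot x)" 2] unfolding G_def
      by (intro mono2) linarith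
    then have "\<Gamma> \<le> G"
      using mult_nonneg_nonpos[OF deriv1 falling]
      unfolding \<Gamma>_def hocbf_term_def by (smt (verit))
    \<comment> \<open>The order matters: \<Gamma> may be negative, so it is replaced by
      \<open>G\<close> before \<open>k\<close> is replaced by \<open>\<kappa>\<close>.\<close>
    then have "k * \<Gamma> \<le> k * G" using \<open>0 \<le> k\<close> by (rule mult_left_mono)
    also have "\<dots> \<le> \<kappa> * G" using \<open>k \<le> \<kappa>\<close> \<open>0 \<le> G\<close> by (rule mult_right_mono)
    finally show ?thesis using accel by (simp add: M_def)
  qed

  \<comment> \<open>Forward invariance along a trajectory\<close>
  have "(pos (x t), rot (x t)) \<in> safe_set q ec \<psi>"
    if law: "qp_control_law q ec \<psi> dhat \<gamma>1 \<gamma>2 K \<gamma>0 dm dM M ustar u"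
      and traj: "closed_loop_trajectory (qp_domain q ec \<psi> dhat \<gamma>1 \<gamma>2 K \<gamma>0 dm dM M ustar) u J x"
      and err: "\<And>t. t \<in> J \<Longrightarrow> rel_err dhat q (pos (x t)) t \<in> {dm..dM}"
      and J: "t0 \<in> J" "t \<in> J" "t0 \<le> t"
      and safe: "(pos (x t0), rot (x t0)) \<in> safe_set q ec \<psi>"
      and adm: "admissible_velocity q ec \<psi> \<gamma>1 (x t0)" for u J x t0 t
  proof -
    let ?h = "\<lambda>s. barrier q ec \<psi> (pos (x s)) (rot (x s))" and ?Lf = "\<lambda>s. Lf_barrier q ec (x s)"
    have sub: "{t0..t} \<subseteq> J"
      using traj J unfolding closed_loop_trajectory_def is_interval_1
      by (metis atLeastAtMost_iff subsetI)
    have dom: "(s, x s) \<in> qp_domain q ec \<psi> dhat \<gamma>1 \<gamma>2 K \<gamma>0 dm dM M ustar" if "s \<in> J" for s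
      using traj that by (auto simp: closed_loop_trajectory_def)
    then have space: "x s \<in> state_space q" if "s \<in> J" for s
      using that by (auto simp: qp_domain_def)
    have dpos: "((\<lambda>s. pos (x s)) has_vector_derivative vel (x s)) (at s within {t0..t})"
      and dvel: "((\<lambda>s. vel (x s)) has_vector_derivative fst (u s (x s))) (at s within {t0..t})"
      and drot: "((\<lambda>s. rot (x s)) has_vector_derivative (rot (x s) ** skew (angvel (x s))))
        (at s within {t0..t})"
      and dangvel: "((\<lambda>s. angvel (x s)) has_vector_derivative snd (u s (x s)))
        (at s within {t0..t})"
      if "s \<in> {t0..t}" for s
      using traj sub that unfolding closed_loop_trajectory_def
      by (meson has_vector_derivative_within_subset subsetD)+
    have ne: "pos (x s) \<noteq> q" if "s \<in> {t0..t}" for s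
      using space[OF subsetD[OF sub that]] by (simp add: state_space_def)
    have "0 \<le> ?h t"
    proof (rule nonneg_if_deriv_rises_while_nonpos[OF _ _ \<open>0 < m\<close> _ _ \<open>t0 \<le> t\<close>])
      fix s assume s: "s \<in> {t0..t}"
      show "(?h has_real_derivative ?Lf s) (at s within {t0..t})"
        by (rule barrier_deriv; rule dpos drot ne; fact s)
      show "(?Lf has_real_derivative barrier_accel_pos q ec (x s) (fst (u s (x s)))
          + barrier_accel_rot q ec (x s) (snd (u s (x s)))) (at s within {t0..t})"
        by (rule Lf_barrier_deriv; rule dpos dvel drot dangvel ne; fact s)
      show "m \<le> barrier_accel_pos q ec (x s) (fst (u s (x s)))
          + barrier_accel_rot q ec (x s) (snd (u s (x s)))" if "?Lf s \<le> 0"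
      proof -
        have "s \<in> J" using s sub by blast
        \<comment> \<open>The trajectory lies in the domain of the law, so the applied control
          solves the program and is in particular feasible.\<close>
        then obtain c1 c2 where
          "qp_feasible q ec \<psi> dhat \<gamma>1 \<gamma>2 K \<gamma>0 dm dM M s (x s) (u s (x s)) c1 c2"
          using law dom unfolding qp_control_law_def qp_solution_def by blast
        from rise[OF this space[OF \<open>s \<in> J\<close>] err[OF \<open>s \<in> J\<close>] that] show ?thesis .
      qed
    next
      have h: "0 \<le> ?h t0" "?h t0 \<le> 2"
        using safe assms(1) by (auto simp: safe_set_def intro!: barrier_le_2)
      have "- (C * ?h t0) \<le> min (?Lf t0) 0"
        using adm C(2)[OF h] C(1) h(1) by (simp add: admissible_velocity_def)
      then have "\<bar>min (?Lf t0) 0\<bar> \<le> \<bar>C * ?h t0\<bar>" by linarith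
      then have "(min (?Lf t0) 0)\<^sup>2 \<le> (C * ?h t0)\<^sup>2"
        by (simp only: abs_le_square_iff)
      also have "\<dots> = C\<^sup>2 * ?h t0 * ?h t0" by (simp add: power2_eq_square)
      \<comment> \<open>Bounding one factor h by 2 turns the quadratic bound into the linear one
        required by the energy argument.\<close>
      also have "\<dots> \<le> C\<^sup>2 * ?h t0 * 2" using h by (intro mult_left_mono) auto
      also have "\<dots> \<le> 2 * m * ?h t0" using h by (simp add: m_def algebra_simps)
      finally show "(min (?Lf t0) 0)\<^sup>2 \<le> 2 * m * ?h t0" .
    qed
    then show ?thesis
      using space[OF J(2)] by (simp add: safe_set_def state_space_def)
  qed
  with \<open>0 < M\<close> show ?thesis by blast
qed

end
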